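(* Let $(a_n)_{n\in\mathbb N_0}$ and $(t_n)_{n\in\mathbb N_0}$ be increasing sequences of natural numbers. Let $B'$ be the standard Bratteli diagram with vertex sets $W_0=\{0\}$ and $W_n=\{0,1,\dots,t_{n-1}\}$ for $n\in\mathbb N$, in which $0\in W_n$ and $0\in W_{n+1}$ are joined by $a_n$ edges and any other pair $w\in W_n$, $v\in W_{n+1}$ is joined by exactly one edge ($n\in\mathbb N_0$). Let $\overline B$ be the vertex subdiagram of $B'$ (the $(a_n)$-odometer) supported by the vertices $0$ at all levels, and let $\nu$ be the unique tail invariant probability measure on $X_{\overline B}$, so that $\nu([\overline e])=1/(a_0\cdots a_{n-1})$ for each finite path $\overline e$ of $\overline B$ from level $0$ to level $n$. Let $X'_{\overline B}\subset X_{B'}$ be the set of all paths of $X_{B'}$ tail equivalent to some path of $X_{\overline B}$, and $\widehat\nu$ the extension of $\nu$ to $X'_{\overline B}$. If $$\sum_{n=0}^\infty\frac{t_n}{a_n}<\infty,$$ then $\widehat\nu(X'_{\overline B})<\infty$.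
   Context: Infinite paths in a Bratteli diagram are sequences $(x_n)_{n\ge0}$ with $x_n$ an edge between level $n$ and level $n+1$ and the range of $x_n$ equal to the source of $x_{n+1}$; $X_{B'}$, $X_{\overline B}$ denote the path spaces, with topology generated by cylinder sets. Two paths are tail equivalent if they agree from some index on. A measure is tail invariant if it gives equal value to cylinder sets whose defining finite paths (from level $0$) end at the same vertex. The extension $\widehat\nu$ is the unique Borel measure (possibly infinite) on $X'_{\overline B}$, invariant for the tail equivalence relation of $B'$, that extends $\nu$: for a finite path $f$ of $B'$ from level $0$ to the vertex $0$ of level $n$, the set of paths that begin with $f$ and afterwards use only edges of $\overline B$ has $\widehat\nu$-measure $1/(a_0\cdots a_{n-1})$. (In the paper $B'$ arises as a vertex subdiagram of a larger one-sided generalized Bratteli diagram $B$ with vertex sets $\mathbb N_0$, and $X'_{\overline B}=\widehat X_{\overline B}\cap X_{B'}$, where $\widehat X_{\overline B}$ is the set of paths of $X_B$ tail equivalent to a path of $X_{\overline B}$.) *)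

theory Defs
  imports "HOL-Probability.Probability"
begin

section \<open>Bratteli diagrams and their path spaces\<close>

record ('v, 'e) bratteli =
  verts :: "nat \<Rightarrow> 'v set"
  edges :: "nat \<Rightarrow> 'e set"  \<comment> \<open>\<open>edges B n\<close>: edges between levels \<open>n\<close> and \<open>n + 1\<close>\<close>
  src :: "'e \<Rightarrow> 'v"
  rng :: "'e \<Rightarrow> 'v"

definition paths :: "('v, 'e) bratteli \<Rightarrow> (nat \<Rightarrow> 'e) set" where
  "paths B = {x. \<forall>n. x n \<in> edges B n \<and> rng B (x n) = src B (x (Suc n))}"

text \<open>
  A finite path from level \<open>0\<close> is a pair of its initial vertex and its list of edges, so that
  the path of length \<open>0\<close> at a vertex also has a well-defined end vertex. The list
  \<open>v # map (rng B) es\<close> consists of the vertices visited.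
\<close>

definition fin_paths :: "('v, 'e) bratteli \<Rightarrow> nat \<Rightarrow> 'v \<Rightarrow> ('v \<times> 'e list) set" where
  "fin_paths B n w = {(v, es). v \<in> verts B 0 \<and> length es = n \<and>
     (\<forall>i<n. es ! i \<in> edges B i \<and> src B (es ! i) = (v # map (rng B) es) ! i) \<and>
     last (v # map (rng B) es) = w}"

definition cylinder :: "('v, 'e) bratteli \<Rightarrow> 'v \<times> 'e list \<Rightarrow> (nat \<Rightarrow> 'e) set" where
  "cylinder B f = {x \<in> paths B. src B (x 0) = fst f \<and> (\<forall>i<length (snd f). x i = snd f ! i)}"

definition path_topology :: "('v, 'e) bratteli \<Rightarrow> (nat \<Rightarrow> 'e) topology" where
  "path_topology B = topology_generated_by {cylinder B f | n w f. f \<in> fin_paths B n w}"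

definition borel_space :: "'x topology \<Rightarrow> 'x measure" where
  "borel_space T = sigma (topspace T) {U. openin T U}"

definition tail_equivalent :: "(nat \<Rightarrow> 'e) \<Rightarrow> (nat \<Rightarrow> 'e) \<Rightarrow> bool" where
  "tail_equivalent x y \<longleftrightarrow> (\<exists>N. \<forall>n\<ge>N. x n = y n)"

text \<open>
  The measure may live on a subset of the path space, in which case the cylinder sets are
  understood relative to that subset.
\<close>

definition tail_invariant :: "('v, 'e) bratteli \<Rightarrow> (nat \<Rightarrow> 'e) measure \<Rightarrow> bool" where
  "tail_invariant B M \<longleftrightarrow>
     (\<forall>n w. \<forall>f\<in>fin_paths B n w. \<forall>g\<in>fin_paths B n w.
        emeasure M (cylinder B f \<inter> space M) = emeasure M (cylinder B g \<inter> space M))"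

definition vertex_subdiagram ::
    "('v, 'e) bratteli \<Rightarrow> (nat \<Rightarrow> 'v set) \<Rightarrow> ('v, 'e) bratteli" where
  "vertex_subdiagram B U =
     \<lparr> verts = U,
       edges = (\<lambda>n. {e \<in> edges B n. src B e \<in> U n \<and> rng B e \<in> U (Suc n)}),
       src = src B, rng = rng B \<rparr>"

definition saturation ::
    "('v, 'e) bratteli \<Rightarrow> ('v, 'e) bratteli \<Rightarrow> (nat \<Rightarrow> 'e) set" where
  "saturation B C = {x \<in> paths B. \<exists>y \<in> paths C. tail_equivalent x y}"


section \<open>The diagram with an odometer along the vertices 0\<close>

fun W :: "(nat \<Rightarrow> nat) \<Rightarrow> nat \<Rightarrow> nat set" where
  "W t 0 = {0}"
| "W t (Suc n) = {0..t n}"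

text \<open>An edge is a triple of its source, a label distinguishing parallel edges, and its range.\<close>

definition diagram :: "(nat \<Rightarrow> nat) \<Rightarrow> (nat \<Rightarrow> nat) \<Rightarrow> (nat, nat \<times> nat \<times> nat) bratteli" where
  "diagram a t =
     \<lparr> verts = W t,
       edges = (\<lambda>n. {(w, k, v). w \<in> W t n \<and> v \<in> W t (Suc n) \<and>
                                 k < (if w = 0 \<and> v = 0 then a n else 1)}),
       src = (\<lambda>(w, k, v). w),
       rng = (\<lambda>(w, k, v). v) \<rparr>"

definition odometer :: "(nat \<Rightarrow> nat) \<Rightarrow> (nat \<Rightarrow> nat) \<Rightarrow> (nat, nat \<times> nat \<times> nat) bratteli" where
  "odometer a t = vertex_subdiagram (diagram a t) (\<lambda>n. {0})"

definition odometer_measure ::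
    "(nat \<Rightarrow> nat) \<Rightarrow> (nat \<Rightarrow> nat) \<Rightarrow> (nat \<Rightarrow> nat \<times> nat \<times> nat) measure \<Rightarrow> bool" where
  "odometer_measure a t \<nu> \<longleftrightarrow>
     prob_space \<nu> \<and>
     space \<nu> = paths (odometer a t) \<and>
     sets \<nu> = sets (borel_space (path_topology (odometer a t))) \<and>
     tail_invariant (odometer a t) \<nu>"

text \<open>
  Cylinder sets may have infinite measure under the extension, so tail invariance and the values on
  \<open>paths (odometer a t)\<close> alone would not determine it; the last clause, prescribing the (finite)
  measure of the paths that begin with a given finite path and then stay in the odometer, does.
\<close>

definition odometer_extension ::
    "(nat \<Rightarrow> nat) \<Rightarrow> (nat \<Rightarrow> nat) \<Rightarrow> (nat \<Rightarrow> nat \<times> nat \<times> nat) measure \<Rightarrow>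
     (nat \<Rightarrow> nat \<times> nat \<times> nat) measure \<Rightarrow> bool" where
  "odometer_extension a t \<nu> \<mu> \<longleftrightarrow>
     (let B = diagram a t; C = odometer a t; X = saturation B C in
       space \<mu> = X \<and>
       sets \<mu> = sets (borel_space (subtopology (path_topology B) X)) \<and>
       tail_invariant B \<mu> \<and>
       (\<forall>A \<in> sets \<nu>. A \<in> sets \<mu> \<and> emeasure \<mu> A = emeasure \<nu> A) \<and>
       (\<forall>n. \<forall>f \<in> fin_paths B n 0.
          emeasure \<mu> {x \<in> cylinder B f. \<forall>m\<ge>n. x m \<in> edges C m} =
          ennreal (1 / real (\<Prod>i<n. a i))))"

end

theory Submission
  imports Defs
begin

text \<open>
  Let \<open>Y n\<close> be the set of paths that stay in the odometer from level \<open>n\<close> on. These sets increase to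
  the saturation, and the extended measure of \<open>Y n\<close> is \<open>1 / (a 0 * \<dots> * a (n - 1))\<close> times the
  number of finite paths from level \<open>0\<close> to the vertex \<open>0\<close> of level \<open>n\<close>. A vertex of level \<open>i\<close> emits at
  most \<open>a i + t i\<close> edges, so there are at most \<open>\<Prod>i<n. a i + t i\<close> finite paths of length \<open>n\<close>
  altogether. Hence the measure of \<open>Y n\<close> is at most \<open>\<Prod>i<n. 1 + t i / a i \<le> exp (\<Sum>i. t i / a i)\<close>,
  uniformly in \<open>n\<close>.
\<close>

text \<open>Cutting off the last edge \<open>e\<close> leaves a path of length \<open>n\<close>
  whose end vertex is the source of \<open>e\<close>. The \<open>SIGMA\<close> form turns path
  counting into a sum of out-degrees.\<close>

lemma fin_paths_Suc_subset:
  "(\<Union>w. fin_paths B (Suc n) w) \<subseteq>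
     (\<lambda>((v, es), e). (v, es @ [e])) `
       (SIGMA p:(\<Union>w. fin_paths B n w).
          {e \<in> edges B n. src B e = last (fst p # map (rng B) (snd p))})"
proof clarify
  fix w v es'
  assume "(v, es') \<in> fin_paths B (Suc n) w"
  then have v: "v \<in> verts B 0" and len: "length es' = Suc n"
    and step: "\<And>i. i < Suc n \<Longrightarrow> es' ! i \<in> edges B i \<and> src B (es' ! i) = (v # map (rng B) es') ! i"
    by (auto simp: fin_paths_def)
  obtain es e where es': "es' = es @ [e]" and es: "length es = n"
    using len by (metis length_Suc_conv_rev)
  \<comment> \<open>Position \<open>0\<close> of the vertex list holds \<open>v\<close>; position
    \<open>i > 0\<close> holds the range of edge \<open>i - 1\<close>, which appending
    \<open>e\<close> does not change.\<close>
  have "es ! i \<in> edges B i \<and> src B (es ! i) = (v # map (rng B) es) ! i" if "i < n" for i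
    using step[of i] that es by (cases i) (auto simp: es' nth_append)
  then have "(v, es) \<in> fin_paths B n (last (v # map (rng B) es))"
    using v es by (auto simp: fin_paths_def)
  moreover have "e \<in> edges B n" "src B e = last (v # map (rng B) es)"
    using step[of n] es by (auto simp: es' nth_append last_conv_nth nth_Cons')
  ultimately show "(v, es') \<in> (\<lambda>((v, es), e). (v, es @ [e])) `
       (SIGMA p:(\<Union>w. fin_paths B n w).
          {e \<in> edges B n. src B e = last (fst p # map (rng B) (snd p))})"
    by (intro image_eqI[of _ _ "((v, es), e)"]) (auto simp: es')
qed

text \<open>Each path of length \<open>n\<close> has at most \<open>d n\<close> extensions by one
  edge. Taking all end vertices together lets the induction run on out-degrees alone. Finiteness is
  carried along because \<open>card\<close> of an infinite set is \<open>0\<close>.\<close>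

lemma card_fin_paths_le:
  assumes fin0: "finite (verts B 0)"
    and fin: "\<And>n w. finite {e \<in> edges B n. src B e = w}"
    and deg: "\<And>n w. card {e \<in> edges B n. src B e = w} \<le> d n"
  shows "finite (\<Union>w. fin_paths B n w) \<and>
    card (\<Union>w. fin_paths B n w) \<le> card (verts B 0) * (\<Prod>i<n. d i)"
proof (induction n)
  case 0
  have "(\<Union>w. fin_paths B 0 w) = (\<lambda>v. (v, [])) ` verts B 0"
    by (auto simp: fin_paths_def)
  then show ?case
    using fin0 by (simp add: card_image_le)
next
  case (Suc n)
  let ?P = "\<Union>w. fin_paths B n w"
  let ?E = "\<lambda>p. {e \<in> edges B n. src B e = last (fst p # map (rng B) (snd p))}"
  have finS: "finite (Sigma ?P ?E)"
    using Suc fin by (intro finite_SigmaI) auto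
  have "card (\<Union>w. fin_paths B (Suc n) w) \<le> card (Sigma ?P ?E)"
    using card_mono[OF finite_imageI[OF finS] fin_paths_Suc_subset] card_image_le[OF finS]
    by (rule order.trans)
  also have "\<dots> = (\<Sum>p\<in>?P. card (?E p))"
    using Suc fin by (intro card_SigmaI) auto
  also have "\<dots> \<le> card ?P * d n"
    using sum_bounded_above[of ?P "\<lambda>p. card (?E p)" "d n"] deg by simp
  also have "\<dots> \<le> card (verts B 0) * (\<Prod>i<Suc n. d i)"
    using Suc by (simp add: mult.assoc[symmetric])
  finally show ?case
    using finite_subset[OF fin_paths_Suc_subset finite_imageI[OF finS]] by (rule conjI[rotated])
qed

lemma path_prefix_in_fin_paths:
  assumes x: "x \<in> paths B" and v: "src B (x 0) \<in> verts B 0"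
  shows "(src B (x 0), map x [0..<n]) \<in> fin_paths B n (src B (x n))"
proof -
  have *: "(src B (x 0) # map (rng B) (map x [0..<n])) ! i = src B (x i)" if "i \<le> n" for i
    using x that by (cases i) (auto simp: paths_def)
  have "last (src B (x 0) # map (rng B) (map x [0..<n])) = src B (x n)"
    using *[of n] by (subst last_conv_nth) auto
  then show ?thesis
    using x v * by (auto simp: fin_paths_def paths_def)
qed

lemma path_in_prefix_cylinder:
  "x \<in> paths B \<Longrightarrow> x \<in> cylinder B (src B (x 0), map x [0..<n])"
  by (simp add: cylinder_def)

lemma saturation_eventually_in_edges:
  assumes "x \<in> saturation B C"
  shows "\<exists>n. \<forall>m\<ge>n. x m \<in> edges C m"
proof -
  obtain y N where "y \<in> paths C" and "\<forall>n\<ge>N. x n = y n"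
    using assms by (auto simp: saturation_def tail_equivalent_def)
  then have "\<forall>m\<ge>N. x m \<in> edges C m"
    by (simp add: paths_def)
  then show ?thesis ..
qed

text \<open>At most \<open>a n\<close> edges lead from \<open>w\<close> to \<open>0\<close>, and one
  edge, with label \<open>0\<close>, to each of \<open>1, ..., t n\<close>. Positivity of
  \<open>a n\<close> covers the single edge to \<open>0\<close> when \<open>w\<close> is not
  \<open>0\<close>.\<close>

lemma diagram_out_edges:
  assumes "0 < a n"
  shows "finite {e \<in> edges (diagram a t) n. src (diagram a t) e = w}"
    and "card {e \<in> edges (diagram a t) n. src (diagram a t) e = w} \<le> a n + t n"
proof -
  let ?E = "{e \<in> edges (diagram a t) n. src (diagram a t) e = w}"
  let ?F = "(\<lambda>k. (w, k, 0)) ` {..<a n} \<union> (\<lambda>v. (w, 0, v)) ` {1..t n}"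
  have sub: "?E \<subseteq> ?F"
    using assms by (auto simp: diagram_def image_iff split: if_splits)
  then show "finite ?E"
    by (rule finite_subset) simp
  have "card ?E \<le> card ?F"
    using sub by (intro card_mono) auto
  also have "\<dots> \<le> a n + t n"
    by (rule order.trans[OF card_Un_le])
       (use card_image_le[of "{..<a n}" "\<lambda>k. (w, k, 0::nat)"]
            card_image_le[of "{1..t n}" "\<lambda>v. (w, 0::nat, v)"] in simp)
  finally show "card ?E \<le> a n + t n" .
qed

text \<open>Apply \<open>1 + x \<le> exp x\<close> to each factor; the partial sums of a nonnegative
  series stay below its sum.\<close>

lemma prod_one_plus_le_exp_suminf:
  fixes r :: "nat \<Rightarrow> real"
  assumes "\<And>n. 0 \<le> r n" "summable r"
  shows "(\<Prod>i<n. 1 + r i) \<le> exp (suminf r)"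
proof -
  have "(\<Prod>i<n. 1 + r i) \<le> (\<Prod>i<n. exp (r i))"
    using assms(1) by (intro prod_mono) (auto intro: exp_ge_add_one_self add_nonneg_nonneg)
  also have "\<dots> = exp (\<Sum>i<n. r i)"
    by (simp add: exp_sum)
  also have "\<dots> \<le> exp (suminf r)"
    using assms by (simp add: sum_le_suminf)
  finally show ?thesis .
qed

theorem theorem5p9:
  fixes a t :: "nat \<Rightarrow> nat"
    and \<nu> \<nu>hat :: "(nat \<Rightarrow> nat \<times> nat \<times> nat) measure"
  assumes "mono a" and "\<And>n. 0 < a n"
    and "mono t" and "\<And>n. 0 < t n"
    and "odometer_measure a t \<nu>"
    and "odometer_extension a t \<nu> \<nu>hat"
    and "summable (\<lambda>n. real (t n) / real (a n))"
  shows "emeasure \<nu>hat (saturation (diagram a t) (odometer a t)) < \<infinity>"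
proof -
  let ?B = "diagram a t" and ?C = "odometer a t"
  define P where "P n = fin_paths ?B n 0" for n
  define Z where "Z n f = {x \<in> cylinder ?B f. \<forall>m\<ge>n. x m \<in> edges ?C m}" for n f
  define Y where "Y n = (\<Union>f\<in>P n. Z n f)" for n
  have Z: "emeasure \<nu>hat (Z n f) = ennreal (1 / real (\<Prod>i<n. a i))" if "f \<in> P n" for n f
    using assms(6) that unfolding odometer_extension_def Let_def P_def Z_def by blast
  have space: "space \<nu>hat = saturation ?B ?C"
    using assms(6) unfolding odometer_extension_def Let_def by blast
  have a_nonzero: "a n \<noteq> 0" for n
    using assms(2)[of n] by simp
  have prod_a_pos: "0 < (\<Prod>i<n. real (a i))" for n
    using assms(2) by (intro prod_pos) simp
  \<comment> \<open>Non-measurable sets have \<open>emeasure\<close> zero, so the prescribed positive value gives measurability.\<close>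
  have Z_sets: "Z n f \<in> sets \<nu>hat" if "f \<in> P n" for n f
    using Z[OF that] prod_a_pos[of n] by (intro emeasure_neq_0_sets) (simp add: ennreal_eq_0_iff)
  have "finite (verts ?B 0)" "card (verts ?B 0) = 1"
    by (simp_all add: diagram_def)
  then have bound: "finite (\<Union>w. fin_paths ?B n w) \<and>
      card (\<Union>w. fin_paths ?B n w) \<le> (\<Prod>i<n. a i + t i)" for n
    using card_fin_paths_le[of ?B "\<lambda>n. a n + t n" n] diagram_out_edges[of a _ t, OF assms(2)] by simp
  have sub: "P n \<subseteq> (\<Union>w. fin_paths ?B n w)" for n
    by (auto simp: P_def)
  have P_fin: "finite (P n)" for n
    using finite_subset[OF sub] bound by simp
  have P_card: "card (P n) \<le> (\<Prod>i<n. a i + t i)" for n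
    using card_mono[OF _ sub] bound le_trans by fast
  have Y_sets: "Y n \<in> sets \<nu>hat" for n
    unfolding Y_def using P_fin Z_sets by (intro sets.finite_UN) auto
  have Y_eq: "Y n = {x \<in> paths ?B. \<forall>m\<ge>n. x m \<in> edges ?C m}" for n
  proof (intro equalityI subsetI)
    fix x assume "x \<in> Y n"
    then show "x \<in> {x \<in> paths ?B. \<forall>m\<ge>n. x m \<in> edges ?C m}"
      by (auto simp: Y_def Z_def cylinder_def)
  next
    fix x assume x: "x \<in> {x \<in> paths ?B. \<forall>m\<ge>n. x m \<in> edges ?C m}"
    then have "x 0 \<in> edges ?B 0"
      by (auto simp: paths_def)
    then have "src ?B (x 0) \<in> verts ?B 0"
      by (auto simp: diagram_def)
    \<comment> \<open>The case \<open>m = n\<close>: an odometer edge starts at \<open>0\<close>, so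
      the prefix of length \<open>n\<close> ends there.\<close>
    moreover have "src ?B (x n) = 0"
      using x by (auto simp: odometer_def vertex_subdiagram_def)
    ultimately have "(src ?B (x 0), map x [0..<n]) \<in> P n"
      using path_prefix_in_fin_paths[of x ?B n] x by (simp add: P_def)
    then show "x \<in> Y n"
      using x path_in_prefix_cylinder[of x ?B n] by (auto simp: Y_def Z_def)
  qed
  have "incseq Y"
    by (auto simp: incseq_def Y_eq)
  moreover have "(\<Union>n. Y n) = saturation ?B ?C"
  proof
    \<comment> \<open>A measurable set lies in the space of \<open>\<nu>hat\<close>, which is the
      saturation, so no tail equivalent odometer path has to be constructed.\<close>
    show "(\<Union>n. Y n) \<subseteq> saturation ?B ?C"
      using Y_sets sets.sets_into_space space by blast
    show "saturation ?B ?C \<subseteq> (\<Union>n. Y n)"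
    proof
      fix x assume x: "x \<in> saturation ?B ?C"
      then have "x \<in> paths ?B"
        by (simp add: saturation_def)
      then show "x \<in> (\<Union>n. Y n)"
        using saturation_eventually_in_edges[OF x] by (auto simp: Y_eq)
    qed
  qed
  \<comment> \<open>Continuity from below reduces the claim to a bound on \<open>Y n\<close> uniform
    in \<open>n\<close>.\<close>
  ultimately have "emeasure \<nu>hat (saturation ?B ?C) = (SUP n. emeasure \<nu>hat (Y n))"
    using SUP_emeasure_incseq[of Y \<nu>hat] Y_sets by (simp add: image_subset_iff)
  also have "\<dots> \<le> ennreal (exp (\<Sum>n. real (t n) / real (a n)))"
  proof (rule SUP_least)
    fix n
    have "real (card (P n)) / (\<Prod>i<n. real (a i)) \<le>
        real (\<Prod>i<n. a i + t i) / (\<Prod>i<n. real (a i))"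
      using P_card[of n] prod_a_pos[of n] by (intro divide_right_mono of_nat_mono) auto
    also have "\<dots> = (\<Prod>i<n. 1 + real (t i) / real (a i))"
      by (simp add: prod_dividef[symmetric] add_divide_distrib a_nonzero)
    also have "\<dots> \<le> exp (\<Sum>n. real (t n) / real (a n))"
      using assms(7) by (intro prod_one_plus_le_exp_suminf) auto
    finally have le: "real (card (P n)) / (\<Prod>i<n. real (a i)) \<le>
        exp (\<Sum>n. real (t n) / real (a n))" .
    have "emeasure \<nu>hat (Y n) \<le> (\<Sum>f\<in>P n. emeasure \<nu>hat (Z n f))"
      unfolding Y_def using P_fin Z_sets by (intro emeasure_subadditive_finite) auto
    also have "\<dots> = (\<Sum>f\<in>P n. ennreal (1 / real (\<Prod>i<n. a i)))"
      by (intro sum.cong refl Z)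
    also have "\<dots> = ennreal (real (card (P n)) / (\<Prod>i<n. real (a i)))"
      by (simp add: ennreal_of_nat_eq_real_of_nat ennreal_mult'[symmetric])
    also have "\<dots> \<le> ennreal (exp (\<Sum>n. real (t n) / real (a n)))"
      using le by (rule ennreal_leI)
    finally show "emeasure \<nu>hat (Y n) \<le> ennreal (exp (\<Sum>n. real (t n) / real (a n)))" .
  qed
  finally show ?thesis
    using ennreal_less_top order_le_less_trans infinity_ennreal_def by metis
qed

end
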